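(* Let $\Phi_1,\Phi_2:\Omega\to\Omega$ be two commuting maps ($\Phi_1\circ\Phi_2=\Phi_2\circ\Phi_1$) satisfying the standing assumptions listed in the context, and let $A_1,A_2:\Omega\to\mathbb{R}$ be Lipschitz functions. If for some Lipschitz function $w:\Omega\to\mathbb{R}$ $$(A_1-A_1\circ\Phi_1)-(A_2-A_2\circ\Phi_2)=(w-w\circ\Phi_1)-(w-w\circ\Phi_1)\circ\Phi_2,$$ then $\mu_{A_2,\Phi_1}=\mu_{A_1,\Phi_2}$, i.e. the equilibrium probability of the potential $A_2$ for the dynamics $\Phi_1$ coincides with the equilibrium probability of the potential $A_1$ for the dynamics $\Phi_2$.
   Context: Let $\Omega=\{1,\dots,r\}^{\mathbb{N}}$ with the metric $d(x,y)=2^{-\min\{j\ge 1:\,x_j\ne y_j\}}$ for $x\neq y$, $d(x,x)=0$. For $\Pi:\Omega\to\Omega$ and a Lipschitz potential $B:\Omega\to\mathbb{R}$, the Ruelle operator on $C(\Omega,\mathbb{R})$ is $\mathcal{L}_{B,\Pi}(f)(y)=\sum_{\Pi(x)=y}e^{B(x)}f(x)$, and $\mathcal{L}_{B,\Pi}^*$ is its dual acting on finite Borel measures. The topological pressure is $P_\Pi(B)=\sup_{\rho}\{h_\Pi(\rho)+\int B\,d\rho\}$, the supremum over $\Pi$-invariant Borel probabilities $\rho$, with $h_\Pi$ the Kolmogorov–Sinai entropy. The maximizing probability $\mu_{B,\Pi}$ is called the equilibrium probability for $B$ and $\Pi$. Standing assumptions: each $\Pi\in\{\Phi_1,\Phi_2\}$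 is a continuous, surjective, $r$-to-$1$, expanding map for which Ruelle's theorem is valid for every Lipschitz potential $B$, that is: (i) there are an eigenvalue $\lambda_{B,\Pi}>0$ of $\mathcal{L}_{B,\Pi}$, simple on $C(\Omega,\mathbb{R})$, with a strictly positive Lipschitz eigenfunction $\psi_{B,\Pi}$, and a probability $\rho_{B,\Pi}$ with $\mathcal{L}_{B,\Pi}^*\rho_{B,\Pi}=\lambda_{B,\Pi}\rho_{B,\Pi}$, and $\log\lambda_{B,\Pi}=P_\Pi(B)$; (ii) any strictly positive continuous $f$ with $\mathcal{L}_{B,\Pi}f=\lambda f$, $\lambda>0$, satisfies $\lambda=\lambda_{B,\Pi}$ and is a multiple of $\psi_{B,\Pi}$; (iii) the equilibrium probability is unique and equals $\mu_{B,\Pi}=\psi_{B,\Pi}\,\rho_{B,\Pi}$ (normalized so that $\int\psi_{B,\Pi}\,d\rho_{B,\Pi}=1$), and adding to $B$ a constant or a function $u-u\circ\Pi$ with $u$ Lipschitz does not change it; (iv) if $\mathcal{L}_{B,\Pi}(1)=1$ then $\mathcal{L}_{B,\Pi}^n(f)\to\int f\,d\mu_{B,\Pi}$ uniformly for every continuous $f$, and $\mathcal{L}_{B,\Pi}^*\mu_{B,\Pi}=\mu_{B,\Pi}$. (The main example is $\Phi_1=\sigma$, the full shift, and $\Phi_2$ a permutative cellular automaton.) *)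

theory Defs
  imports "HOL-Probability.Probability"
begin

section \<open>The sequence space\<close>

text \<open>
  The alphabet is an arbitrary finite nonempty type \<open>'r\<close>, so that the number of letters is
  \<open>CARD('r)\<close>. The function type already carries a different metric in HOL-Analysis, hence
  the wrapper type.
\<close>

typedef 'r sequences = "UNIV :: (nat \<Rightarrow> 'r) set"
  morphisms coord of_coords
  by simp

text \<open>
  Coordinates are numbered from 0 here and from 1 in the usual formula for the metric, which
  accounts for the successor in the exponent.
\<close>

instantiation sequences :: (type) metric_space
begin

definition dist_sequences :: "'a sequences \<Rightarrow> 'a sequences \<Rightarrow> real" where
  "dist_sequences x y =
     (if x = y then 0 else (1 / 2) ^ Suc (LEAST j. coord x j \<noteq> coord y j))"

definition uniformity_sequences :: "('a sequences \<times> 'a sequences) filter" where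
  "uniformity_sequences = (INF e\<in>{0 <..}. principal {(x, y). dist x y < e})"

definition open_sequences :: "'a sequences set \<Rightarrow> bool" where
  "open_sequences U \<longleftrightarrow> (\<forall>x\<in>U. eventually (\<lambda>(x', y). x' = x \<longrightarrow> y \<in> U) uniformity)"

instance
proof
  fix x y z :: "'a sequences"
  show "dist x y = 0 \<longleftrightarrow> x = y"
    by (simp add: dist_sequences_def)
  have nonneg: "0 \<le> dist u v" for u v :: "'a sequences"
    by (simp add: dist_sequences_def)
  show "dist x y \<le> dist x z + dist y z"
  proof (cases "x = y \<or> x = z \<or> y = z")
    case True
    then consider "x = y" | "x = z" | "y = z" by blast
    then show ?thesis
    proof cases
      case 1
      then show ?thesis using nonneg[of y z] by (simp add: dist_sequences_def)
    next
      case 2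
      have "(LEAST j. coord z j \<noteq> coord y j) = (LEAST j. coord y j \<noteq> coord z j)"
        by metis
      with 2 show ?thesis by (simp add: dist_sequences_def)
    next
      case 3
      then show ?thesis by (simp add: dist_sequences_def)
    qed
  next
    case False
    let ?m = "\<lambda>u v. LEAST j. coord u j \<noteq> coord v j"
    have "\<exists>j. coord x j \<noteq> coord y j"
      using False coord_inject[of x y] by blast
    then have "coord x (?m x y) \<noteq> coord y (?m x y)"
      by (rule LeastI_ex)
    then have "coord x (?m x y) \<noteq> coord z (?m x y) \<or> coord y (?m x y) \<noteq> coord z (?m x y)"
      by metis
    then have "?m x z \<le> ?m x y \<or> ?m y z \<le> ?m x y"
      using Least_le[of "\<lambda>j. coord x j \<noteq> coord z j"] Least_le[of "\<lambda>j. coord y j \<noteq> coord z j"]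
      by blast
    then have "(1 / 2 :: real) ^ Suc (?m x y) \<le> (1 / 2) ^ Suc (?m x z) \<or>
        (1 / 2 :: real) ^ Suc (?m x y) \<le> (1 / 2) ^ Suc (?m y z)"
      using power_decreasing[of "Suc _" "Suc _" "1 / 2 :: real"] by simp
    then have "dist x y \<le> dist x z \<or> dist x y \<le> dist y z"
      using False by (simp add: dist_sequences_def)
    then show ?thesis
      using nonneg[of x z] nonneg[of y z] by linarith
  qed
qed (simp_all add: uniformity_sequences_def open_sequences_def)

end

definition lipschitz_fun :: "('a::metric_space \<Rightarrow> real) \<Rightarrow> bool" where
  "lipschitz_fun f \<longleftrightarrow> (\<exists>C. C-lipschitz_on UNIV f)"


section \<open>Entropy, pressure and equilibrium probabilities\<close>

definition invariant_prob :: "('a::topological_space \<Rightarrow> 'a) \<Rightarrow> 'a measure \<Rightarrow> bool" where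
  "invariant_prob T \<rho> \<longleftrightarrow>
     prob_space \<rho> \<and> sets \<rho> = sets borel \<and> distr \<rho> borel T = \<rho>"

definition finite_borel_partition :: "'a::topological_space set set \<Rightarrow> bool" where
  "finite_borel_partition P \<longleftrightarrow> finite P \<and> partition_on UNIV P \<and> P \<subseteq> sets borel"

definition partition_entropy :: "'a measure \<Rightarrow> 'a set set \<Rightarrow> real" where
  "partition_entropy \<rho> P = - (\<Sum>A\<in>P. measure \<rho> A * ln (measure \<rho> A))"

text \<open>The join of the preimages of \<open>P\<close> under \<open>T ^^ i\<close>, for \<open>i < n\<close>.\<close>

definition dynamical_join :: "('a \<Rightarrow> 'a) \<Rightarrow> nat \<Rightarrow> 'a set set \<Rightarrow> 'a set set" where
  "dynamical_join T n P = common_refinement ((\<lambda>i. (\<lambda>A. (T ^^ i) -` A) ` P) ` {..<n})"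

definition entropy_wrt_partition :: "('a \<Rightarrow> 'a) \<Rightarrow> 'a measure \<Rightarrow> 'a set set \<Rightarrow> real" where
  "entropy_wrt_partition T \<rho> P =
     lim (\<lambda>n. partition_entropy \<rho> (dynamical_join T n P) / real n)"

definition KS_entropy :: "('a::topological_space \<Rightarrow> 'a) \<Rightarrow> 'a measure \<Rightarrow> ereal" where
  "KS_entropy T \<rho> = (SUP P\<in>{P. finite_borel_partition P}. ereal (entropy_wrt_partition T \<rho> P))"

definition pressure :: "('a::topological_space \<Rightarrow> 'a) \<Rightarrow> ('a \<Rightarrow> real) \<Rightarrow> ereal" where
  "pressure T B = (SUP \<rho>\<in>{\<rho>. invariant_prob T \<rho>}. KS_entropy T \<rho> + ereal (\<integral>x. B x \<partial>\<rho>))"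

definition maximizing_prob ::
  "('a::topological_space \<Rightarrow> 'a) \<Rightarrow> ('a \<Rightarrow> real) \<Rightarrow> 'a measure \<Rightarrow> bool" where
  "maximizing_prob T B \<mu> \<longleftrightarrow>
     invariant_prob T \<mu> \<and> KS_entropy T \<mu> + ereal (\<integral>x. B x \<partial>\<mu>) = pressure T B"

text \<open>Meaningful only if there is exactly one maximizing probability.\<close>

definition equilibrium_prob ::
  "('a::topological_space \<Rightarrow> 'a) \<Rightarrow> ('a \<Rightarrow> real) \<Rightarrow> 'a measure" where
  "equilibrium_prob T B = (THE \<mu>. maximizing_prob T B \<mu>)"


section \<open>The Ruelle operator\<close>

definition ruelle_op :: "('a \<Rightarrow> 'a) \<Rightarrow> ('a \<Rightarrow> real) \<Rightarrow> ('a \<Rightarrow> real) \<Rightarrow> 'a \<Rightarrow> real" where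
  "ruelle_op T B f y = (\<Sum>x\<in>T -` {y}. exp (B x) * f x)"

text \<open>
  The dual operator on finite Borel measures, as a relation: \<open>ruelle_dual T B \<nu> \<nu>'\<close> says that
  the image of \<open>\<nu>\<close> under the dual operator is \<open>\<nu>'\<close>. On a compact metric space \<open>\<nu>'\<close> is
  determined by \<open>\<nu>\<close>.
\<close>

definition ruelle_dual ::
  "('a::topological_space \<Rightarrow> 'a) \<Rightarrow> ('a \<Rightarrow> real) \<Rightarrow> 'a measure \<Rightarrow> 'a measure \<Rightarrow> bool" where
  "ruelle_dual T B \<nu> \<nu>' \<longleftrightarrow>
     finite_measure \<nu> \<and> sets \<nu> = sets borel \<and> finite_measure \<nu>' \<and> sets \<nu>' = sets borel \<and>
     (\<forall>f. continuous_on UNIV f \<longrightarrow> (\<integral>x. f x \<partial>\<nu>') = (\<integral>y. ruelle_op T B f y \<partial>\<nu>))"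

text \<open>Simple means that the eigenspace in the space of continuous functions is a line.\<close>

definition simple_eigenvalue ::
  "('a::topological_space \<Rightarrow> 'a) \<Rightarrow> ('a \<Rightarrow> real) \<Rightarrow> real \<Rightarrow> bool" where
  "simple_eigenvalue T B l \<longleftrightarrow>
     (\<exists>g. g \<noteq> (\<lambda>x. 0) \<and>
        {f. continuous_on UNIV f \<and> ruelle_op T B f = (\<lambda>y. l * f y)} = range (\<lambda>c x. c * g x))"

definition expanding :: "('a::metric_space \<Rightarrow> 'a) \<Rightarrow> bool" where
  "expanding T \<longleftrightarrow>
     (\<exists>\<kappa>>1. \<exists>\<epsilon>>0. \<forall>x y. dist x y < \<epsilon> \<longrightarrow> \<kappa> * dist x y \<le> dist (T x) (T y))"


section \<open>Ruelle's theorem as a hypothesis on a map\<close>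

text \<open>
  In the following, \<open>l\<close>, \<open>\<psi>\<close> and \<open>\<rho>\<close> are the eigenvalue, the eigenfunction and the eigenmeasure
  belonging to the map \<open>T\<close> and the potential \<open>B\<close>.
\<close>

definition ruelle_spectral ::
  "('a::metric_space \<Rightarrow> 'a) \<Rightarrow> ('a \<Rightarrow> real) \<Rightarrow> real \<Rightarrow> ('a \<Rightarrow> real) \<Rightarrow> 'a measure \<Rightarrow> bool" where
  "ruelle_spectral T B l \<psi> \<rho> \<longleftrightarrow>
     l > 0 \<and> simple_eigenvalue T B l \<and>
     lipschitz_fun \<psi> \<and> (\<forall>x. \<psi> x > 0) \<and> ruelle_op T B \<psi> = (\<lambda>y. l * \<psi> y) \<and>
     prob_space \<rho> \<and> sets \<rho> = sets borel \<and> ruelle_dual T B \<rho> (scale_measure (ennreal l) \<rho>) \<and>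
     pressure T B = ereal (ln l)"

definition ruelle_positive_eigenfunctions ::
  "('a::metric_space \<Rightarrow> 'a) \<Rightarrow> ('a \<Rightarrow> real) \<Rightarrow> real \<Rightarrow> ('a \<Rightarrow> real) \<Rightarrow> bool" where
  "ruelle_positive_eigenfunctions T B l \<psi> \<longleftrightarrow>
     (\<forall>f l'. continuous_on UNIV f \<and> (\<forall>x. f x > 0) \<and> l' > 0 \<and> ruelle_op T B f = (\<lambda>y. l' * f y)
        \<longrightarrow> l' = l \<and> (\<exists>c. f = (\<lambda>x. c * \<psi> x)))"

definition ruelle_equilibrium ::
  "('a::metric_space \<Rightarrow> 'a) \<Rightarrow> ('a \<Rightarrow> real) \<Rightarrow> ('a \<Rightarrow> real) \<Rightarrow> 'a measure \<Rightarrow> bool" where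
  "ruelle_equilibrium T B \<psi> \<rho> \<longleftrightarrow>
     (\<integral>x. \<psi> x \<partial>\<rho>) = 1 \<and>
     (\<forall>\<mu>. maximizing_prob T B \<mu> \<longleftrightarrow> \<mu> = density \<rho> (\<lambda>x. ennreal (\<psi> x))) \<and>
     (\<forall>c. equilibrium_prob T (\<lambda>x. B x + c) = equilibrium_prob T B) \<and>
     (\<forall>u. lipschitz_fun u \<longrightarrow>
        equilibrium_prob T (\<lambda>x. B x + (u x - u (T x))) = equilibrium_prob T B)"

definition ruelle_convergence ::
  "('a::metric_space \<Rightarrow> 'a) \<Rightarrow> ('a \<Rightarrow> real) \<Rightarrow> bool" where
  "ruelle_convergence T B \<longleftrightarrow>
     (ruelle_op T B (\<lambda>x. 1) = (\<lambda>y. 1) \<longrightarrow>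
        (\<forall>f. continuous_on UNIV f \<longrightarrow>
           uniform_limit UNIV (\<lambda>n. (ruelle_op T B ^^ n) f)
             (\<lambda>y. \<integral>x. f x \<partial>equilibrium_prob T B) sequentially) \<and>
        ruelle_dual T B (equilibrium_prob T B) (equilibrium_prob T B))"

definition ruelle_theorem_valid :: "('a::metric_space \<Rightarrow> 'a) \<Rightarrow> bool" where
  "ruelle_theorem_valid T \<longleftrightarrow>
     (\<forall>B. lipschitz_fun B \<longrightarrow>
        (\<exists>l \<psi> \<rho>. ruelle_spectral T B l \<psi> \<rho> \<and> ruelle_positive_eigenfunctions T B l \<psi> \<and>
           ruelle_equilibrium T B \<psi> \<rho> \<and> ruelle_convergence T B))"

definition ruelle_map :: "('r::finite sequences \<Rightarrow> 'r sequences) \<Rightarrow> bool" where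
  "ruelle_map T \<longleftrightarrow>
     continuous_on UNIV T \<and> surj T \<and> (\<forall>y. card (T -` {y}) = CARD('r)) \<and> expanding T \<and>
     ruelle_theorem_valid T"

end

theory Submission
  imports Defs
begin

text \<open>
  Adding to each potential a constant and a coboundary of its own map makes both Ruelle operators
  fix the constant 1 and only changes \<open>w\<close>. Twisting the first operator by \<open>w\<close> then makes it
  commute with the second one, so the second operator maps the fixed function \<open>exp (- w)\<close> of the
  twisted one to a multiple of itself; uniqueness of positive eigenfunctions forces \<open>w\<close> to be
  constant. Hence the two normalized operators themselves commute, and iterating the first one on
  \<open>L\<^sub>2 f\<close> shows that its equilibrium probability is invariant under the dual of \<open>L\<^sub>2\<close>; iterating
  \<open>L\<^sub>2\<close> identifies the two probabilities.

  The normalization needs \<open>u \<circ> T\<close> to be Lipschitz for Lipschitz \<open>u\<close>, whereas \<open>T\<close> is only assumed to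
  be continuous and expanding. That \<open>T\<close> is Lipschitz follows by counting cylinders.
\<close>

section \<open>Cylinders and compactness\<close>

text \<open>The fibres of \<open>word n\<close> are the cylinders of length \<open>n\<close>; as
  lists over a finite alphabet they can be counted.\<close>

definition word :: "nat \<Rightarrow> 'r sequences \<Rightarrow> 'r list" where
  "word n x = map (coord x) [0..<n]"

lemma word_eq_iff: "word n x = word n y \<longleftrightarrow> (\<forall>j<n. coord x j = coord y j)"
  by (auto simp: word_def)

text \<open>A first disagreement at index \<open>m\<close> means distance
  \<open>(1 / 2) ^ Suc m\<close>. So cylinders of length \<open>n\<close> are the open balls of
  radius \<open>(1 / 2) ^ n\<close>, and metric claims become combinatorial.\<close>

lemma word_eq_iff_dist: "word n x = word n y \<longleftrightarrow> dist x y < (1 / 2) ^ n"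
proof (cases "x = y")
  case False
  define m where "m = (LEAST j. coord x j \<noteq> coord y j)"
  have "\<exists>j. coord x j \<noteq> coord y j"
    using False coord_inject[of x y] by blast
  then have m: "coord x m \<noteq> coord y m"
    unfolding m_def by (rule LeastI_ex)
  have below: "coord x j = coord y j" if "j < m" for j
    using not_less_Least[of j "\<lambda>j. coord x j \<noteq> coord y j"] that unfolding m_def by blast
  have "word n x = word n y \<longleftrightarrow> n \<le> m"
    unfolding word_eq_iff using m below by (meson linorder_not_less order_less_le_trans)
  also have "\<dots> \<longleftrightarrow> (1 / 2 :: real) ^ Suc m < (1 / 2) ^ n"
    by (subst power_strict_decreasing_iff) auto
  finally show ?thesis
    using False by (simp add: dist_sequences_def m_def)
qed simp

lemma dist_eq_power:
  assumes "x \<noteq> y"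
  obtains m where "dist (x :: 'r sequences) y = (1 / 2) ^ Suc m"
  using assms by (auto simp: dist_sequences_def)

lemma range_word: "range (word n :: 'r sequences \<Rightarrow> _) = {xs. length xs = n}"
proof -
  have "xs \<in> range (word n)" if "length xs = n" for xs :: "'r list"
    using that
    by (intro image_eqI[of _ _ "of_coords (\<lambda>j. xs ! j)"])
      (auto simp: word_def of_coords_inverse intro!: nth_equalityI)
  then show ?thesis
    by (auto simp: word_def)
qed

lemma finite_range_word: "finite (range (word n :: 'r::finite sequences \<Rightarrow> _))"
  using finite_lists_length_eq[of "UNIV :: 'r set" n] by (simp add: range_word)

lemma card_range_word: "card (range (word n :: 'r::finite sequences \<Rightarrow> _)) = CARD('r) ^ n"
  using card_lists_length_eq[of "UNIV :: 'r set" n] by (simp add: range_word)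

lemma complete_sequences: "uniform_space_class.complete (UNIV :: 'r sequences set)"
  unfolding Real_Vector_Spaces.complete_def
proof (intro allI impI)
  fix s :: "nat \<Rightarrow> 'r sequences"
  assume "(\<forall>n. s n \<in> UNIV) \<and> Cauchy s"
  then have "\<exists>M. \<forall>m\<ge>M. \<forall>k\<ge>M. word n (s m) = word n (s k)" for n
    unfolding word_eq_iff_dist by (auto simp: Cauchy_def)
  then obtain M where M: "\<And>n m k. m \<ge> M n \<Longrightarrow> k \<ge> M n \<Longrightarrow> word n (s m) = word n (s k)"
    by metis
  define l where "l = of_coords (\<lambda>j. coord (s (M (Suc j))) j)"
  have l: "word n (s m) = word n l" if "\<forall>j\<le>n. M j \<le> m" for n m
    unfolding word_eq_iff l_def of_coords_inverse[OF UNIV_I]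
  proof (intro allI impI)
    fix j assume "j < n"
    then have "word (Suc j) (s m) = word (Suc j) (s (M (Suc j)))"
      using that by (intro M) auto
    then show "coord (s m) j = coord (s (M (Suc j))) j"
      by (auto simp: word_eq_iff)
  qed
  have "s \<longlonglongrightarrow> l"
    unfolding lim_sequentially
  proof (intro allI impI)
    fix e :: real assume "e > 0"
    then obtain n where n: "(1 / 2) ^ n < e"
      using real_arch_pow_inv[of e "1 / 2"] by auto
    \<comment> \<open>The sum serves as a common upper bound of all \<open>M j\<close> with
      \<open>j \<le> n\<close>.\<close>
    have "dist (s m) l < e" if "m \<ge> (\<Sum>j\<le>n. M j)" for m
    proof -
      have "M j \<le> m" if "j \<le> n" for j
        using member_le_sum[of j "{..n}" M] that \<open>m \<ge> _\<close> by auto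
      then show ?thesis
        using l[of n m] n unfolding word_eq_iff_dist by fastforce
    qed
    then show "\<exists>no. \<forall>m\<ge>no. dist (s m) l < e" by blast
  qed
  then show "\<exists>l\<in>UNIV. s \<longlonglongrightarrow> l" by blast
qed

text \<open>One representative of each of the finitely many cylinders of length \<open>n\<close>
  gives a finite net.\<close>

lemma compact_sequences: "compact (UNIV :: 'r::finite sequences set)"
  unfolding compact_eq_totally_bounded
proof (intro conjI allI impI complete_sequences)
  fix e :: real assume "e > 0"
  then obtain n where n: "(1 / 2) ^ n < e"
    using real_arch_pow_inv[of e "1 / 2"] by auto
  define k :: "'r sequences set" where "k = (\<lambda>u. SOME x. word n x = u) ` range (word n)"
  have "finite k"
    unfolding k_def by (intro finite_imageI finite_range_word)
  moreover have "x \<in> (\<Union>y\<in>k. ball y e)" for x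
  proof -
    have "word n (SOME y. word n y = word n x) = word n x"
      by (rule someI) simp
    then have "dist (SOME y. word n y = word n x) x < e"
      unfolding word_eq_iff_dist using n by linarith
    then show ?thesis unfolding k_def by auto
  qed
  ultimately show "\<exists>k. finite k \<and> UNIV \<subseteq> (\<Union>y\<in>k. ball (y :: 'r sequences) e)"
    by blast
qed


section \<open>Expanding maps with constant fibre cardinality\<close>

lemma closed_cylinder: "closed {x :: 'r sequences. word n x = u}"
proof -
  have "open {x. word n x \<noteq> u}"
    unfolding open_dist
  proof (intro ballI exI conjI allI impI)
    fix x y assume "x \<in> {x. word n x \<noteq> u}" "dist y x < (1 / 2) ^ n"
    then show "y \<in> {x. word n x \<noteq> u}" 
      using word_eq_iff_dist[of n y x] by auto
  qed simp
  then show ?thesis by (simp add: closed_def Compl_eq)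
qed

text \<open>Collects the topological and metric hypotheses; they yield continuity of fibre sums and
  the Lipschitz property of \<open>T\<close>.\<close>

locale expanding_cover =
  fixes T :: "'r::finite sequences \<Rightarrow> 'r sequences"
  assumes continuous: "continuous_on UNIV T"
    and card_fibre: "\<And>y. card (T -` {y}) = CARD('r)"
    and expanding: "expanding T"
begin

lemma finite_fibre: "finite (T -` {y})"
  by (rule card_ge_0_finite) (simp add: card_fibre)

text \<open>\<open>M\<close> is so large that points of one cylinder are closer than
  \<open>\<epsilon>\<close>. Recording strict growth instead of the factor \<open>\<kappa>\<close>
  suffices later: distances are powers of 1/2, so a strict increase is at least a doubling.\<close>

lemma expansion:
  "\<exists>M. (\<forall>x y. word M x = word M y \<longrightarrow> x \<noteq> y \<longrightarrow> dist x y < dist (T x) (T y)) \<and>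
    (\<forall>u. inj_on T {x. word M x = u})"
proof -
  obtain \<kappa> \<epsilon> where *: "\<kappa> > 1" "\<epsilon> > 0" "\<And>x y. dist x y < \<epsilon> \<Longrightarrow> \<kappa> * dist x y \<le> dist (T x) (T y)"
    using expanding unfolding expanding_def by blast
  obtain M where M: "(1 / 2) ^ M < \<epsilon>"
    using real_arch_pow_inv[of \<epsilon> "1 / 2"] * by auto
  have less: "dist x y < dist (T x) (T y)" if "word M x = word M y" "x \<noteq> y" for x y
  proof -
    have "dist x y < \<kappa> * dist x y" "\<kappa> * dist x y \<le> dist (T x) (T y)"
      using * M that by (auto simp: word_eq_iff_dist)
    then show ?thesis by linarith
  qed
  have "inj_on T {x. word M x = u}" for u
  proof (rule inj_onI, rule ccontr)
    fix x y assume "x \<in> {x. word M x = u}" "y \<in> {x. word M x = u}" "T x = T y" "x \<noteq> y"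
    then have "dist x y < 0" using less[of x y] by simp
    then show False by simp
  qed
  with less show ?thesis by blast
qed

text \<open>When \<open>T\<close> is injective on cylinders of length \<open>M\<close>, these are
  the domains of its inverse branches.\<close>

definition piece :: "nat \<Rightarrow> 'r list \<Rightarrow> 'r sequences set" where
  "piece M u = T ` {x. word M x = u}"

lemma compact_cylinder: "compact {x :: 'r sequences. word n x = u}"
  using compact_Int_closed[OF compact_sequences closed_cylinder[of n u]] by simp

lemma closed_piece: "closed (piece M u)"
  unfolding piece_def
  by (intro compact_imp_closed compact_continuous_image compact_cylinder
      continuous_on_subset[OF continuous]) auto

text \<open>
  The number of words \<open>u\<close> with \<open>y \<in> piece M u\<close> does not depend on \<open>y\<close>, while the set of these
  words can only shrink near \<open>y\<close>, because the pieces are closed; hence it is locally constant.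
\<close>

lemma open_piece:
  assumes inj: "\<And>u. inj_on T {x. word M x = u}"
  shows "open (piece M u)"
proof -
  define W where "W y = {u. y \<in> piece M u}" for y
  have W_eq: "W y = word M ` (T -` {y})" for y
    by (auto simp: W_def piece_def)
  have finW: "finite (W y)" for y
    unfolding W_eq using finite_fibre by simp
  have cardW: "card (W y) = CARD('r)" for y
  proof -
    have "inj_on (word M) (T -` {y})"
      using inj by (auto simp: inj_on_def)
    then show ?thesis unfolding W_eq by (simp add: card_image card_fibre)
  qed
  show ?thesis
  proof (rule Topological_Spaces.openI)
    fix y assume y: "y \<in> piece M u"
    define U where "U = - (\<Union>v\<in>range (word M) - W y. piece M v)"
    have "open U"
      unfolding U_def using closed_piece finite_range_word
      by (intro open_Compl closed_UN finite_Diff) blast+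
    moreover have "y \<in> U" unfolding U_def W_def by blast
    moreover have "U \<subseteq> piece M u"
    proof
      fix y' assume "y' \<in> U"
      then have "W y' \<inter> range (word M) \<subseteq> W y"
        unfolding U_def W_def by blast
      moreover have "W y' \<subseteq> range (word M)"
        unfolding W_eq by (rule image_mono) simp
      ultimately have "W y' \<subseteq> W y" by blast
      then have "W y' = W y"
        by (rule card_subset_eq[OF finW]) (simp only: cardW)
      then show "y' \<in> piece M u" using y unfolding W_def by blast
    qed
    ultimately show "\<exists>U. open U \<and> y \<in> U \<and> U \<subseteq> piece M u" by blast
  qed
qed

text \<open>The indicator of a clopen piece is continuous, hence uniformly continuous by
  compactness.\<close>

lemma piece_uniformly_open:
  assumes inj: "\<And>u. inj_on T {x. word M x = u}"
  obtains d where "d > 0"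
    and "\<And>u y y'. y \<in> piece M u \<Longrightarrow> dist y y' < d \<Longrightarrow> y' \<in> piece M u"
proof -
  have "\<exists>d>0. \<forall>y y'. y \<in> piece M u \<longrightarrow> dist y y' < d \<longrightarrow> y' \<in> piece M u" for u
  proof -
    have "continuous_on (piece M u \<union> - piece M u) (\<lambda>y. if y \<in> piece M u then 1 else 0 :: real)"
      by (intro continuous_on_cases closed_piece continuous_intros)
        (auto simp: closed_Compl open_piece[OF inj])
    then have "uniformly_continuous_on UNIV (\<lambda>y. if y \<in> piece M u then 1 else 0 :: real)"
      by (intro compact_uniformly_continuous compact_sequences) simp
    then obtain d where "d > 0" and d: "\<And>y y'. dist y' y < d \<Longrightarrow>
        dist (if y' \<in> piece M u then 1 else 0 :: real) (if y \<in> piece M u then 1 else 0) < 1"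
      unfolding uniformly_continuous_on_def by (metis UNIV_I zero_less_one)
    show ?thesis
    proof (intro exI conjI allI impI)
      fix y y' assume "y \<in> piece M u" "dist y y' < d"
      then show "y' \<in> piece M u" using d[of y y'] by (auto split: if_splits)
    qed fact
  qed
  then obtain d where d: "\<And>u. d u > 0"
    "\<And>u y y'. y \<in> piece M u \<Longrightarrow> dist y y' < d u \<Longrightarrow> y' \<in> piece M u"
    by metis
  define D where "D = Min (d ` range (word M :: 'r sequences \<Rightarrow> _))"
  show ?thesis
  proof
    show "D > 0"
      unfolding D_def using d by (subst Min_gr_iff) (auto simp: finite_range_word)
    fix u y y' assume *: "y \<in> piece M u" "dist y y' < D"
    then have "D \<le> d u"
      unfolding D_def by (intro Min_le finite_imageI finite_range_word) (auto simp: piece_def)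
    with * show "y' \<in> piece M u" using d(2) by fastforce
  qed
qed

text \<open>Each inverse branch \<open>g u\<close> is continuous on its clopen piece, so
  \<open>h\<close> composed with it and extended by 0 is continuous. A cylinder contains at most one
  point of a fibre, so the fibre sum is a finite sum of such functions.\<close>

lemma continuous_on_fibre_sum:
  fixes h :: "'r sequences \<Rightarrow> real"
  assumes h: "continuous_on UNIV h"
  shows "continuous_on UNIV (\<lambda>y. \<Sum>x\<in>T -` {y}. h x)"
proof -
  obtain M where inj: "\<And>u. inj_on T {x. word M x = u}"
    using expansion by blast
  define g where "g u = the_inv_into {x. word M x = u} T" for u
  have g: "continuous_on (piece M u) (g u)" for u
    unfolding g_def piece_def
    by (intro continuous_on_inv_into compact_cylinder inj continuous_on_subset[OF continuous]) auto
  have "continuous_on (piece M u \<union> - piece M u) (\<lambda>y. if y \<in> piece M u then h (g u y) else 0)" for u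
    by (intro continuous_on_cases closed_piece continuous_intros
        continuous_on_compose2[OF h g])
      (auto simp: closed_Compl open_piece[OF inj])
  then have "continuous_on UNIV
      (\<lambda>y. \<Sum>u\<in>range (word M). if y \<in> piece M u then h (g u y) else 0)"
    by (intro continuous_on_sum) simp
  moreover have "(\<Sum>x\<in>T -` {y}. h x) =
      (\<Sum>u\<in>range (word M). if y \<in> piece M u then h (g u y) else 0)" for y
  proof -
    have "(\<Sum>x\<in>T -` {y}. h x) = (\<Sum>u\<in>range (word M). \<Sum>x\<in>{x\<in>T -` {y}. word M x = u}. h x)"
      by (intro sum.group[symmetric] finite_fibre finite_range_word) auto
    also have "\<dots> = (\<Sum>u\<in>range (word M). if y \<in> piece M u then h (g u y) else 0)"
    proof (intro sum.cong refl)
      fix u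
      show "(\<Sum>x\<in>{x\<in>T -` {y}. word M x = u}. h x) = (if y \<in> piece M u then h (g u y) else 0)"
      proof (cases "y \<in> piece M u")
        case True
        then obtain x where x: "word M x = u" "T x = y" by (auto simp: piece_def)
        then have "{x\<in>T -` {y}. word M x = u} = {x}"
          using inj[of u] by (auto simp: inj_on_def)
        moreover have "g u y = x"
          unfolding g_def using the_inv_into_f_f[OF inj[of u], of x] x by simp
        ultimately show ?thesis using True by simp
      next
        case False
        then have "{x\<in>T -` {y}. word M x = u} = {}" by (auto simp: piece_def)
        then show ?thesis using False by (simp only: sum.empty if_False)
      qed
    qed
    finally show ?thesis .
  qed
  ultimately show ?thesis by simp
qed

lemma continuous_on_ruelle_op:
  assumes "continuous_on UNIV B" "continuous_on UNIV f"
  shows "continuous_on UNIV (ruelle_op T B f)"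
  unfolding ruelle_op_def by (intro continuous_on_fibre_sum continuous_intros assms)

text \<open>If \<open>y'\<close> is close to \<open>T x\<close>, it lies in the piece of
  \<open>x\<close> and has a preimage in the cylinder of \<open>x\<close>. Since \<open>T\<close> at
  least doubles distances there, pulling back gains one coordinate.\<close>

lemma lift_word:
  obtains N where "\<And>n x y'. n \<ge> N \<Longrightarrow> word n (T x) = word n y' \<Longrightarrow>
    \<exists>x'. T x' = y' \<and> word (Suc n) x = word (Suc n) x'"
proof -
  obtain M where M: "\<And>x y. word M x = word M y \<Longrightarrow> x \<noteq> y \<Longrightarrow> dist x y < dist (T x) (T y)"
    and inj: "\<And>u. inj_on T {x. word M x = u}"
    using expansion by blast
  obtain d where d: "d > 0" "\<And>u y y'. y \<in> piece M u \<Longrightarrow> dist y y' < d \<Longrightarrow> y' \<in> piece M u"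
    using piece_uniformly_open[OF inj] by blast
  obtain N where N: "(1 / 2) ^ N < d"
    using real_arch_pow_inv[of d "1 / 2"] d by auto
  show ?thesis
  proof
    fix n x y' assume n: "n \<ge> N" "word n (T x) = word n y'"
    have "(1 / 2 :: real) ^ n \<le> (1 / 2) ^ N"
      using n by (intro power_decreasing) auto
    then have "dist (T x) y' < d"
      using n(2)[unfolded word_eq_iff_dist] N by linarith
    moreover have "T x \<in> piece M (word M x)" by (auto simp: piece_def)
    ultimately have "y' \<in> piece M (word M x)" using d by blast
    then obtain x' where x': "y' = T x'" "x' \<in> {z. word M z = word M x}"
      unfolding piece_def by (rule imageE)
    then have wx: "word M x = word M x'" by simp
    have "word (Suc n) x = word (Suc n) x'"
    proof (cases "x = x'")
      case False
      obtain k where k: "dist x x' = (1 / 2) ^ Suc k" by (rule dist_eq_power[OF False])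
      have less: "dist x x' < dist (T x) (T x')" using M[OF wx False] .
      then obtain m where m: "dist (T x) (T x') = (1 / 2) ^ Suc m"
        using dist_eq_power[of "T x" "T x'"] by fastforce
      have "(1 / 2 :: real) ^ Suc m < (1 / 2) ^ n"
        using n x' m by (simp add: word_eq_iff_dist)
      then have "n < Suc m" by (subst (asm) power_strict_decreasing_iff) auto
      moreover have "Suc m < Suc k"
        using less unfolding k m by (subst (asm) power_strict_decreasing_iff) auto
      ultimately have "Suc n < Suc k" by simp
      then have "(1 / 2 :: real) ^ Suc k < (1 / 2) ^ Suc n"
        by (subst power_strict_decreasing_iff) auto
      then show ?thesis by (simp only: word_eq_iff_dist k)
    qed simp
    then show "\<exists>x'. T x' = y' \<and> word (Suc n) x = word (Suc n) x'" using x' by blast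
  qed
qed

text \<open>
  Counting: the preimage of each of the \<open>r ^ n\<close> cylinders of length \<open>n\<close> meets at most \<open>r\<close>
  cylinders of length \<open>n + 1\<close>, and there are \<open>r ^ (n + 1)\<close> of the latter, so none of them is met
  by two such preimages.
\<close>

lemma word_eq_imp_word_image_eq:
  obtains N where
    "\<And>n x x'. n \<ge> N \<Longrightarrow> word (Suc n) x = word (Suc n) x' \<Longrightarrow> word n (T x) = word n (T x')"
proof -
  obtain N where N: "\<And>n x y'. n \<ge> N \<Longrightarrow> word n (T x) = word n y' \<Longrightarrow>
      \<exists>x'. T x' = y' \<and> word (Suc n) x = word (Suc n) x'"
    using lift_word by blast
  show ?thesis
  proof
    fix n and x x' :: "'r sequences"
    assume n: "n \<ge> N" and eq: "word (Suc n) x = word (Suc n) x'"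
    \<comment> \<open>One sample point per cylinder of length \<open>n\<close>: lifting moves any
      point, within its cylinder of length \<open>Suc n\<close>, to a preimage of a sample point, so
      the counting takes place in the finite set \<open>X\<close>.\<close>
    define c :: "'r list \<Rightarrow> 'r sequences" where "c u = (SOME y. word n y = u)" for u
    have c: "word n (c (word n y)) = word n y" for y
      unfolding c_def by (rule someI) simp
    define X where "X = (\<Union>u\<in>range (word n). T -` {c u})"
    have finX: "finite X"
      unfolding X_def by (intro finite_UN_I finite_range_word finite_fibre)
    have "card X \<le> (\<Sum>u\<in>range (word n :: 'r sequences \<Rightarrow> _). card (T -` {c u}))"
      unfolding X_def by (intro card_UN_le finite_range_word)
    also have "\<dots> = CARD('r) ^ Suc n"
      by (simp add: card_fibre card_range_word)
    finally have cardX: "card X \<le> CARD('r) ^ Suc n" .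
    have lift: "\<exists>p\<in>X. T p = c (word n (T z)) \<and> word (Suc n) z = word (Suc n) p" for z
      using N[OF n, of z "c (word n (T z))"] c unfolding X_def by fastforce
    then have "range (word (Suc n)) = word (Suc n) ` X" by fastforce
    then have "card (word (Suc n) ` X) = CARD('r) ^ Suc n"
      using card_range_word by metis
    then have "inj_on (word (Suc n)) X"
      using cardX card_image_le[OF finX, of "word (Suc n)"]
      by (intro eq_card_imp_inj_on finX) linarith
    moreover obtain p p' where "p \<in> X" "p' \<in> X"
      and p: "T p = c (word n (T x))" "word (Suc n) x = word (Suc n) p"
      and p': "T p' = c (word n (T x'))" "word (Suc n) x' = word (Suc n) p'"
      using lift by metis
    ultimately have "p = p'" using eq by (auto dest: inj_onD)
    then show "word n (T x) = word n (T x')" using p p' c by metis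
  qed
qed

text \<open>Losing one coordinate under \<open>T\<close> costs at most a factor 4 at small
  distances; at distances of at least \<open>(1 / 2) ^ Suc N\<close> the trivial bound 1 on all
  distances suffices. The constant covers both cases.\<close>

lemma lipschitz: "\<exists>C. C-lipschitz_on UNIV T"
proof -
  obtain N where N:
    "\<And>n x x'. n \<ge> N \<Longrightarrow> word (Suc n) x = word (Suc n) x' \<Longrightarrow> word n (T x) = word n (T x')"
    using word_eq_imp_word_image_eq by blast
  have "dist (T x) (T y) \<le> 2 ^ (N + 2) * dist x y" for x y
  proof (cases "x = y")
    case False
    then obtain k where k: "dist x y = (1 / 2) ^ Suc k" by (rule dist_eq_power)
    show ?thesis
    proof (cases "k \<le> N")
      case True
      have "dist (T x) (T y) < 1"
        using word_eq_iff_dist[of 0 "T x" "T y"] by (simp add: word_def)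
      also have "(1 :: real) = 2 ^ Suc k * (1 / 2) ^ Suc k"
        by (simp add: power_one_over)
      also have "\<dots> \<le> 2 ^ (N + 2) * (1 / 2) ^ Suc k"
        using True by (intro mult_right_mono power_increasing) auto
      finally show ?thesis unfolding k by (rule less_imp_le)
    next
      case False
      then obtain n where n: "k = Suc n" "n \<ge> N" by (cases k) auto
      have "word (Suc n) x = word (Suc n) y"
        unfolding word_eq_iff_dist k n by simp
      then have "dist (T x) (T y) < (1 / 2) ^ n"
        using N n word_eq_iff_dist by blast
      also have "(1 / 2) ^ n = 2 ^ 2 * dist x y" by (simp add: k n)
      also have "\<dots> \<le> 2 ^ (N + 2) * dist x y"
        by (intro mult_right_mono power_increasing) auto
      finally show ?thesis by (rule less_imp_le)
    qed
  qed simp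
  then have "(2 ^ (N + 2))-lipschitz_on UNIV T"
    by (intro lipschitz_onI) auto
  then show ?thesis ..
qed

end


section \<open>Measures and Ruelle operators\<close>

text \<open>Indicators of closed sets are limits of bounded continuous functions, and closed sets
  form an intersection-stable generator.\<close>

lemma measure_eqI_continuous:
  fixes M N :: "'a::metric_space measure"
  assumes M: "finite_measure M" "sets M = sets borel"
    and N: "finite_measure N" "sets N = sets borel"
    and eq: "\<And>f :: 'a \<Rightarrow> real. continuous_on UNIV f \<Longrightarrow> bounded (range f) \<Longrightarrow>
      (\<integral>x. f x \<partial>M) = (\<integral>x. f x \<partial>N)"
  shows "M = N"
proof -
  have lim: "(\<lambda>n. \<integral>x. max 0 (1 - real n * infdist x C) \<partial>L) \<longlonglongrightarrow> measure L C"
    if L: "finite_measure L" "sets L = sets borel" and C: "closed C" "C \<noteq> {}"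
    for L and C :: "'a set"
  proof -
    interpret L: finite_measure L by fact
    have [measurable_cong]: "sets L = sets borel" by fact
    have [measurable]: "C \<in> sets borel" using C by simp
    have [measurable]: "(\<lambda>x. max 0 (1 - real n * infdist x C)) \<in> borel_measurable borel" for n
      by (intro borel_measurable_continuous_onI continuous_intros)
    have "(\<lambda>n. \<integral>x. max 0 (1 - real n * infdist x C) \<partial>L) \<longlonglongrightarrow> (\<integral>x. indicator C x \<partial>L)"
    proof (rule integral_dominated_convergence[where w = "\<lambda>_. 1"])
      show "AE x in L. (\<lambda>n. max 0 (1 - real n * infdist x C)) \<longlonglongrightarrow> indicator C x"
      proof (intro AE_I2)
        fix x
        show "(\<lambda>n. max 0 (1 - real n * infdist x C)) \<longlonglongrightarrow> indicator C x"
        proof (cases "x \<in> C")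
          case False
          then have pos: "infdist x C > 0"
            using infdist_pos_not_in_closed C by blast
          obtain n0 where n0: "1 < real n0 * infdist x C"
            using ex_less_of_nat_mult[OF pos] by blast
          have "max 0 (1 - real n * infdist x C) = 0" if "n \<ge> n0" for n
          proof -
            have "real n0 * infdist x C \<le> real n * infdist x C"
              using that pos by (intro mult_right_mono) auto
            then show ?thesis using n0 by simp
          qed
          then have "eventually (\<lambda>n. max 0 (1 - real n * infdist x C) = 0) sequentially"
            by (auto simp: eventually_sequentially)
          then show ?thesis using False by (simp add: tendsto_eventually)
        qed simp
      qed
    qed (auto simp: infdist_nonneg)
    then show ?thesis using sets_eq_imp_space_eq[OF L(2)] by simp
  qed
  have bounded: "bounded (range (\<lambda>x. max 0 (1 - real n * infdist x C)))" for n and C :: "'a set"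
    by (rule boundedI[where B = 1]) (auto simp: infdist_nonneg)
  have emeasure_eq: "emeasure M C = emeasure N C" if C: "closed C" for C
  \<comment> \<open>The empty set is separate because \<open>infdist x {} = 0\<close> would make the
    approximating functions constantly 1.\<close>
  proof (cases "C = {}")
    case False
    have "(\<integral>x. max 0 (1 - real n * infdist x C) \<partial>M) =
        (\<integral>x. max 0 (1 - real n * infdist x C) \<partial>N)" for n
      by (intro eq bounded continuous_intros)
    then have "measure M C = measure N C"
      using LIMSEQ_unique[OF lim[OF M C False]] lim[OF N C False] by presburger
    then show ?thesis
      unfolding finite_measure.emeasure_eq_measure[OF M(1)]
        finite_measure.emeasure_eq_measure[OF N(1)] by (rule arg_cong)
  qed simp
  show ?thesis
  proof (rule measure_eqI_generator_eq[where E = "Collect closed" and \<Omega> = UNIV and A = "\<lambda>_. UNIV"])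
    show "Int_stable (Collect closed :: 'a set set)" by (auto simp: Int_stable_def)
    show "sets M = sigma_sets UNIV (Collect closed)" "sets N = sigma_sets UNIV (Collect closed)"
      using M N by (simp_all add: borel_eq_closed)
    show "emeasure M UNIV \<noteq> \<infinity>" for i :: nat
      using finite_measure.emeasure_finite[OF M(1)] by simp
  qed (auto simp: emeasure_eq)
qed

section \<open>Composition and conjugation of Ruelle operators\<close>

lemma ruelle_op_compose:
  assumes "\<And>y. finite (T -` {y})" "\<And>y. finite (S -` {y})"
  shows "ruelle_op T B (ruelle_op S C f) y =
    (\<Sum>x\<in>(T \<circ> S) -` {y}. exp (B (S x) + C x) * f x)"
proof -
  have "ruelle_op T B (ruelle_op S C f) y =
      (\<Sum>z\<in>T -` {y}. \<Sum>x\<in>S -` {z}. exp (B z) * (exp (C x) * f x))"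
    by (simp add: ruelle_op_def sum_distrib_left)
  also have "\<dots> = (\<Sum>z\<in>T -` {y}. \<Sum>x\<in>{x\<in>(T \<circ> S) -` {y}. S x = z}. exp (B (S x) + C x) * f x)"
    by (intro sum.cong refl) (auto simp: exp_add mult.assoc)
  also have "\<dots> = (\<Sum>x\<in>(T \<circ> S) -` {y}. exp (B (S x) + C x) * f x)"
  proof (intro sum.group assms)
    have "(T \<circ> S) -` {y} = (\<Union>z\<in>T -` {y}. S -` {z})" by auto
    then show "finite ((T \<circ> S) -` {y})" using assms by (metis finite_UN)
  qed auto
  finally show ?thesis .
qed

text \<open>Both composites sum over the fibres of the same map, and the last assumption equates
  their weights.\<close>

lemma ruelle_op_commute:
  assumes "\<And>y. finite (T -` {y})" "\<And>y. finite (S -` {y})"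
    and "T \<circ> S = S \<circ> T" and "\<And>x. B (S x) + C x = C (T x) + B x"
  shows "ruelle_op T B (ruelle_op S C f) = ruelle_op S C (ruelle_op T B f)"
proof
  fix y
  show "ruelle_op T B (ruelle_op S C f) y = ruelle_op S C (ruelle_op T B f) y"
    unfolding ruelle_op_compose[OF assms(1,2)] ruelle_op_compose[OF assms(2,1)] assms(3,4) ..
qed

text \<open>On the fibre over \<open>y\<close> the function \<open>u (T x)\<close> has the constant
  value \<open>u y\<close>. A coboundary thus conjugates the operator by multiplication with
  \<open>exp u\<close>.\<close>

lemma ruelle_op_coboundary:
  "ruelle_op T (\<lambda>x. B x + (u x - u (T x)) + c) f y =
    exp (c - u y) * ruelle_op T B (\<lambda>x. exp (u x) * f x) y"
  unfolding ruelle_op_def sum_distrib_left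
  by (intro sum.cong refl) (auto simp: exp_add exp_diff)

lemma ruelle_op_cmult: "ruelle_op T B (\<lambda>x. c * f x) = (\<lambda>y. c * ruelle_op T B f y)"
  by (simp add: ruelle_op_def sum_distrib_left mult.left_commute fun_eq_iff)

section \<open>Lipschitz functions\<close>

lemma lipschitz_fun_add:
  assumes "lipschitz_fun f" "lipschitz_fun g"
  shows "lipschitz_fun (\<lambda>x. f x + g x)"
  using assms unfolding lipschitz_fun_def by (blast intro: lipschitz_on_add)

lemma lipschitz_fun_diff:
  assumes "lipschitz_fun f" "lipschitz_fun g"
  shows "lipschitz_fun (\<lambda>x. f x - g x)"
  using assms unfolding lipschitz_fun_def by (blast intro: lipschitz_on_diff)

lemma lipschitz_fun_const: "lipschitz_fun (\<lambda>x. c)"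
  unfolding lipschitz_fun_def by (blast intro: lipschitz_on_constant)

lemma lipschitz_fun_compose:
  assumes "lipschitz_fun f" "C-lipschitz_on UNIV T"
  shows "lipschitz_fun (\<lambda>x. f (T x))"
proof -
  obtain D where "D-lipschitz_on UNIV f" using assms unfolding lipschitz_fun_def by blast
  then have "(D * C)-lipschitz_on UNIV (\<lambda>x. f (T x))"
    using lipschitz_on_compose2[OF assms(2)] lipschitz_on_subset by blast
  then show ?thesis unfolding lipschitz_fun_def by blast
qed

lemma continuous_on_lipschitz_fun: "lipschitz_fun f \<Longrightarrow> continuous_on UNIV f"
  unfolding lipschitz_fun_def by (blast intro: lipschitz_on_continuous_on)

text \<open>Compactness provides a positive minimum \<open>f x0\<close>, and
  \<open>ln t \<le> t - 1\<close> gives the Lipschitz constant \<open>C / f x0\<close>.\<close>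

lemma lipschitz_fun_ln:
  fixes f :: "'a::metric_space \<Rightarrow> real"
  assumes "compact (UNIV :: 'a set)" "lipschitz_fun f" "\<And>x. f x > 0"
  shows "lipschitz_fun (\<lambda>x. ln (f x))"
proof -
  obtain x0 where x0: "\<And>x. f x0 \<le> f x"
    using continuous_attains_inf[OF assms(1) _ continuous_on_lipschitz_fun[OF assms(2)]] by auto
  obtain C where C: "C-lipschitz_on UNIV f" using assms(2) unfolding lipschitz_fun_def by blast
  have one_sided: "ln (f x) - ln (f y) \<le> C / f x0 * dist x y" for x y
  proof -
    have "ln (f x) - ln (f y) = ln (f x / f y)"
      using assms(3)[of x] assms(3)[of y] by (simp add: ln_div)
    also have "\<dots> \<le> f x / f y - 1"
      using assms(3) by (intro ln_le_minus_one) simp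
    also have "\<dots> = (f x - f y) / f y"
      using assms(3)[of y] by (simp add: field_simps)
    also have "\<dots> \<le> \<bar>f x - f y\<bar> / f x0"
      using assms(3) x0[of y] by (intro frac_le) auto
    also have "\<dots> \<le> C * dist x y / f x0"
      using lipschitz_onD[OF C, of x y] less_imp_le[OF assms(3)[of x0]]
      by (intro divide_right_mono) (auto simp: dist_real_def)
    finally show ?thesis by simp
  qed
  have "(C / f x0)-lipschitz_on UNIV (\<lambda>x. ln (f x))"
  proof (rule lipschitz_onI)
    show "dist (ln (f x)) (ln (f y)) \<le> C / f x0 * dist x y" for x y
      using one_sided[of x y] one_sided[of y x] by (simp add: dist_real_def dist_commute)
    show "0 \<le> C / f x0"
      using lipschitz_on_nonneg[OF C] assms(3)[of x0] by simp
  qed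
  then show ?thesis unfolding lipschitz_fun_def by blast
qed

section \<open>Consequences of Ruelle's theorem and normalization\<close>

lemma ruelle_map_expanding_cover: "ruelle_map T \<Longrightarrow> expanding_cover T"
  by (simp add: ruelle_map_def expanding_cover_def)

lemma ruelle_map_continuous_on_ruelle_op:
  assumes "ruelle_map T" "lipschitz_fun B" "continuous_on UNIV f"
  shows "continuous_on UNIV (ruelle_op T B f)"
  by (rule expanding_cover.continuous_on_ruelle_op[OF ruelle_map_expanding_cover[OF assms(1)]
        continuous_on_lipschitz_fun[OF assms(2)] assms(3)])

lemma ruelle_map_eigendata:
  assumes "ruelle_map T" "lipschitz_fun B"
  obtains l \<psi> \<rho> where "ruelle_spectral T B l \<psi> \<rho>" "ruelle_positive_eigenfunctions T B l \<psi>"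
    "ruelle_equilibrium T B \<psi> \<rho>" "ruelle_convergence T B"
  using assms unfolding ruelle_map_def ruelle_theorem_valid_def by blast

text \<open>Ruelle's theorem makes the maximizing measure unique, so the definite description is
  meaningful.\<close>

lemma maximizing_equilibrium_prob:
  assumes "ruelle_map T" "lipschitz_fun B"
  shows "maximizing_prob T B (equilibrium_prob T B)"
proof -
  obtain \<psi> \<rho> where "ruelle_equilibrium T B \<psi> \<rho>"
    using ruelle_map_eigendata[OF assms] by blast
  then have "maximizing_prob T B \<mu> \<longleftrightarrow> \<mu> = density \<rho> (\<lambda>x. ennreal (\<psi> x))" for \<mu>
    by (simp add: ruelle_equilibrium_def)
  then show ?thesis by (simp add: equilibrium_prob_def)
qed

lemma
  assumes "ruelle_map T" "lipschitz_fun B"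
  shows prob_space_equilibrium_prob: "prob_space (equilibrium_prob T B)"
    and sets_equilibrium_prob: "sets (equilibrium_prob T B) = sets borel"
  using maximizing_equilibrium_prob[OF assms]
  by (simp_all add: maximizing_prob_def invariant_prob_def)

text \<open>With \<open>u = ln \<psi>\<close> the conjugation turns the eigenfunction
  \<open>\<psi>\<close> into 1, and \<open>c = - ln l\<close> turns the eigenvalue into 1. The new
  potential is Lipschitz because \<open>T\<close> is.\<close>

lemma exists_normalized_potential:
  assumes T: "ruelle_map T" and B: "lipschitz_fun B"
  obtains u c where "lipschitz_fun u" "lipschitz_fun (\<lambda>x. B x + (u x - u (T x)) + c)"
    "ruelle_op T (\<lambda>x. B x + (u x - u (T x)) + c) (\<lambda>x. 1) = (\<lambda>y. 1)"
    "equilibrium_prob T (\<lambda>x. B x + (u x - u (T x)) + c) = equilibrium_prob T B"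
proof -
  interpret expanding_cover T by (rule ruelle_map_expanding_cover[OF T])
  obtain l \<psi> \<rho> where *: "ruelle_spectral T B l \<psi> \<rho>" "ruelle_equilibrium T B \<psi> \<rho>"
    using ruelle_map_eigendata[OF T B] by blast
  then have l: "l > 0" and \<psi>: "lipschitz_fun \<psi>" "\<And>x. \<psi> x > 0"
    and eigen: "ruelle_op T B \<psi> = (\<lambda>y. l * \<psi> y)"
    by (auto simp: ruelle_spectral_def)
  define u where "u = (\<lambda>x. ln (\<psi> x))"
  define B' where "B' = (\<lambda>x. B x + (u x - u (T x)))"
  obtain C where C: "C-lipschitz_on UNIV T" using lipschitz by blast
  have u: "lipschitz_fun u"
    unfolding u_def by (intro lipschitz_fun_ln compact_sequences \<psi>)
  have B': "lipschitz_fun B'"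
    unfolding B'_def by (intro lipschitz_fun_add lipschitz_fun_diff B u lipschitz_fun_compose[OF _ C])
  have "equilibrium_prob T (\<lambda>x. B' x + - ln l) = equilibrium_prob T B'"
  proof -
    obtain \<psi>' \<rho>' where "ruelle_equilibrium T B' \<psi>' \<rho>'"
      using ruelle_map_eigendata[OF T B'] by blast
    then show ?thesis unfolding ruelle_equilibrium_def by blast
  qed
  also have "\<dots> = equilibrium_prob T B"
    using *(2) u unfolding ruelle_equilibrium_def B'_def by blast
  finally have eq: "equilibrium_prob T (\<lambda>x. B' x + - ln l) = equilibrium_prob T B" .
  have "ruelle_op T (\<lambda>x. B' x + - ln l) (\<lambda>x. 1) y = 1" for y
  proof -
    have "ruelle_op T (\<lambda>x. B' x + - ln l) (\<lambda>x. 1) y = exp (- ln l - u y) * ruelle_op T B \<psi> y"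
      unfolding B'_def ruelle_op_coboundary using \<psi>(2) by (simp add: u_def)
    then show ?thesis
      using l \<psi>(2)[of y] by (simp add: eigen exp_diff exp_minus u_def)
  qed
  then show ?thesis
    using that[OF u, of "- ln l"] eq lipschitz_fun_add[OF B' lipschitz_fun_const[of "- ln l"]]
    unfolding B'_def by (simp add: fun_eq_iff)
qed

text \<open>The constant 1 is itself a positive eigenfunction, so \<open>\<psi>\<close>, and with it
  every multiple of it, is constant.\<close>

lemma normalized_positive_eigenfunction:
  assumes "ruelle_map T" "lipschitz_fun B" and norm: "ruelle_op T B (\<lambda>x. 1) = (\<lambda>y. 1)"
    and f: "continuous_on UNIV f" "\<And>x. f x > 0" "l > 0" "ruelle_op T B f = (\<lambda>y. l * f y)"
  shows "\<exists>c. f = (\<lambda>x. c)"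
proof -
  obtain l' \<psi> where *: "ruelle_positive_eigenfunctions T B l' \<psi>"
    using ruelle_map_eigendata[OF assms(1,2)] by blast
  obtain c where c: "f = (\<lambda>x. c * \<psi> x)"
    using * f unfolding ruelle_positive_eigenfunctions_def by blast
  obtain d where d: "(\<lambda>x. 1) = (\<lambda>x. d * \<psi> x)"
    using *[unfolded ruelle_positive_eigenfunctions_def, rule_format, of "\<lambda>x. 1" 1] norm by auto
  have "\<psi> x = 1 / d" for x
    using fun_cong[OF d, of x] by (metis mult_zero_left nonzero_mult_div_cancel_left zero_neq_one)
  with c show ?thesis by auto
qed

section \<open>Commuting normalized operators\<close>

lemma ruelle_op_funpow_commute:
  assumes "\<And>f. ruelle_op T B (ruelle_op S C f) = ruelle_op S C (ruelle_op T B f)"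
  shows "(ruelle_op T B ^^ n) (ruelle_op S C f) = ruelle_op S C ((ruelle_op T B ^^ n) f)"
  by (induction n) (simp_all add: assms)

text \<open>Both sides are the limit of \<open>L\<^sub>T ^ n\<close> applied to \<open>L\<^sub>S f\<close>, at any point.\<close>

lemma integral_ruelle_op_commuting:
  assumes T: "ruelle_map T" "lipschitz_fun B" "ruelle_op T B (\<lambda>x. 1) = (\<lambda>y. 1)"
    and S: "ruelle_map S" "lipschitz_fun C" "ruelle_op S C (\<lambda>x. 1) = (\<lambda>y. 1)"
    and comm: "\<And>f. ruelle_op T B (ruelle_op S C f) = ruelle_op S C (ruelle_op T B f)"
    and f: "continuous_on UNIV f"
  shows "(\<integral>x. ruelle_op S C f x \<partial>equilibrium_prob T B) = (\<integral>x. f x \<partial>equilibrium_prob T B)"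
proof -
  define I where "I f = (\<integral>x. f x \<partial>equilibrium_prob T B)" for f :: "'a sequences \<Rightarrow> real"
  have "ruelle_convergence T B"
    using ruelle_map_eigendata[OF T(1,2)] by blast
  then have lim: "(\<lambda>n. (ruelle_op T B ^^ n) g y) \<longlonglongrightarrow> I g" if "continuous_on UNIV g" for g y
    using T(3) that unfolding ruelle_convergence_def I_def
    by (auto intro: tendsto_uniform_limitI)
  fix y
  \<comment> \<open>Pointwise convergence is enough here: at \<open>y\<close> the operator of
    \<open>S\<close> is a fixed finite sum.\<close>
  have "(\<lambda>n. ruelle_op S C ((ruelle_op T B ^^ n) f) y) \<longlonglongrightarrow> ruelle_op S C (\<lambda>x. I f) y"
    unfolding ruelle_op_def[of S] by (intro tendsto_intros lim f)
  moreover have "ruelle_op S C (\<lambda>x. I f) y = I f"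
    using ruelle_op_cmult[of S C "I f" "\<lambda>x. 1"] S(3) by simp
  moreover have "(\<lambda>n. (ruelle_op T B ^^ n) (ruelle_op S C f) y) \<longlonglongrightarrow> I (ruelle_op S C f)"
    by (intro lim ruelle_map_continuous_on_ruelle_op S f)
  ultimately show "I (ruelle_op S C f) = I f"
    unfolding ruelle_op_funpow_commute[OF comm] by (metis LIMSEQ_unique)
qed

text \<open>Integration against \<open>\<mu>\<close> is unchanged by the operator of
  \<open>S\<close>, whose iterates of \<open>f\<close> tend uniformly to the constant
  \<open>\<nu>\<close>-integral of \<open>f\<close>; so both integrals agree.\<close>

lemma equilibrium_prob_eq_commuting:
  assumes T: "ruelle_map T" "lipschitz_fun B" "ruelle_op T B (\<lambda>x. 1) = (\<lambda>y. 1)"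
    and S: "ruelle_map S" "lipschitz_fun C" "ruelle_op S C (\<lambda>x. 1) = (\<lambda>y. 1)"
    and comm: "\<And>f. ruelle_op T B (ruelle_op S C f) = ruelle_op S C (ruelle_op T B f)"
  shows "equilibrium_prob T B = equilibrium_prob S C"
proof -
  define \<mu> \<nu> where "\<mu> = equilibrium_prob T B" and "\<nu> = equilibrium_prob S C"
  interpret \<mu>: prob_space \<mu> unfolding \<mu>_def by (rule prob_space_equilibrium_prob[OF T(1,2)])
  interpret \<nu>: prob_space \<nu> unfolding \<nu>_def by (rule prob_space_equilibrium_prob[OF S(1,2)])
  have sets_\<mu>[measurable_cong]: "sets \<mu> = sets borel"
    unfolding \<mu>_def by (rule sets_equilibrium_prob[OF T(1,2)])
  have sets_\<nu>: "sets \<nu> = sets borel"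
    unfolding \<nu>_def by (rule sets_equilibrium_prob[OF S(1,2)])
  have "(\<integral>x. f x \<partial>\<mu>) = (\<integral>x. f x \<partial>\<nu>)" if f: "continuous_on UNIV f" for f :: "'a sequences \<Rightarrow> real"
  proof -
    have cont: "continuous_on UNIV ((ruelle_op S C ^^ n) f)" for n
      by (induction n) (simp_all add: f ruelle_map_continuous_on_ruelle_op S)
    have int: "integrable \<mu> ((ruelle_op S C ^^ n) f)" for n
    proof -
      have "bounded (range ((ruelle_op S C ^^ n) f))"
        using compact_continuous_image[OF cont compact_sequences] by (rule compact_imp_bounded)
      then obtain b where "\<And>x. norm ((ruelle_op S C ^^ n) f x) \<le> b"
        unfolding bounded_iff by blast
      then show ?thesis
        using borel_measurable_continuous_onI[OF cont]
        by (intro \<mu>.integrable_const_bound[where B = b]) (auto simp: measurable_cong_sets[OF sets_\<mu>])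
    qed
    have const: "(\<integral>x. (ruelle_op S C ^^ n) f x \<partial>\<mu>) = (\<integral>x. f x \<partial>\<mu>)" for n
    proof (induction n)
      case (Suc n)
      then show ?case
        using integral_ruelle_op_commuting[OF T S comm cont[of n]] by (simp add: \<mu>_def)
    qed simp
    have "ruelle_convergence S C"
      using ruelle_map_eigendata[OF S(1,2)] by blast
    then have unif: "uniform_limit UNIV (\<lambda>n. (ruelle_op S C ^^ n) f) (\<lambda>y. \<integral>x. f x \<partial>\<nu>) sequentially"
      using S(3) f unfolding ruelle_convergence_def \<nu>_def by blast
    have "\<bar>(\<integral>x. f x \<partial>\<mu>) - (\<integral>x. f x \<partial>\<nu>)\<bar> \<le> e" if "e > 0" for e
    proof -
      obtain n where n: "\<And>y. \<bar>(ruelle_op S C ^^ n) f y - (\<integral>x. f x \<partial>\<nu>)\<bar> < e"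
        using uniform_limitD[OF unif \<open>e > 0\<close>] by (auto simp: eventually_sequentially dist_real_def)
      have "(\<integral>x. f x \<partial>\<mu>) - (\<integral>x. f x \<partial>\<nu>) = (\<integral>y. (ruelle_op S C ^^ n) f y - (\<integral>x. f x \<partial>\<nu>) \<partial>\<mu>)"
        using int[of n] by (simp add: const \<mu>.prob_space)
      also have "\<bar>\<dots>\<bar> \<le> (\<integral>y. \<bar>(ruelle_op S C ^^ n) f y - (\<integral>x. f x \<partial>\<nu>)\<bar> \<partial>\<mu>)"
        by (rule integral_abs_bound)
      also have "\<dots> \<le> (\<integral>y. e \<partial>\<mu>)"
        using int[of n] n by (intro integral_mono) (auto intro: less_imp_le)
      finally show ?thesis by (simp add: \<mu>.prob_space)
    qed
    then show ?thesis using dense_ge[of 0 "\<bar>(\<integral>x. f x \<partial>\<mu>) - (\<integral>x. f x \<partial>\<nu>)\<bar>"] by fastforce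
  qed
  then have "\<mu> = \<nu>"
    by (intro measure_eqI_continuous sets_\<mu> sets_\<nu> \<mu>.finite_measure_axioms \<nu>.finite_measure_axioms)
  then show ?thesis by (simp add: \<mu>_def \<nu>_def)
qed

lemma equilibrium_prob_eq_normalized:
  assumes comm: "T \<circ> S = S \<circ> T"
    and T: "ruelle_map T" "lipschitz_fun B" "ruelle_op T B (\<lambda>x. 1) = (\<lambda>y. 1)"
    and S: "ruelle_map S" "lipschitz_fun C" "ruelle_op S C (\<lambda>x. 1) = (\<lambda>y. 1)"
    and w: "lipschitz_fun w"
    and eq: "\<And>x. (C x - C (T x)) - (B x - B (S x)) =
      (w x - w (T x)) - (w (S x) - w (T (S x)))"
  shows "equilibrium_prob T B = equilibrium_prob S C"
proof -
  interpret T: expanding_cover T by (rule ruelle_map_expanding_cover[OF T(1)])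
  interpret S: expanding_cover S by (rule ruelle_map_expanding_cover[OF S(1)])
  define B' where "B' = (\<lambda>x. B x + (w x - w (T x)) + 0)"
  define v where "v = (\<lambda>x. exp (- w x))"
  define g where "g = ruelle_op S C v"
  have op_B': "ruelle_op T B' f y = v y * ruelle_op T B (\<lambda>x. f x / v x) y" for f y
    unfolding B'_def ruelle_op_coboundary v_def by (simp add: exp_minus field_simps)
  have v: "continuous_on UNIV v" "\<And>x. v x > 0"
    unfolding v_def using continuous_on_lipschitz_fun[OF w] by (auto intro: continuous_intros)
  have op_v: "ruelle_op T B' v = v"
    using v(2) T(3) by (simp add: fun_eq_iff op_B' less_imp_neq[symmetric])
  \<comment> \<open>The twist absorbs exactly the right-hand side of \<open>eq\<close>.\<close>
  have "B' (S x) + C x = C (T x) + B' x" for x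
    using eq[of x] by (simp add: B'_def)
  then have "ruelle_op T B' (ruelle_op S C f) = ruelle_op S C (ruelle_op T B' f)" for f
    by (intro ruelle_op_commute T.finite_fibre S.finite_fibre comm)
  then have op_g: "ruelle_op T B' g = g"
    unfolding g_def by (simp add: op_v)
  have g: "continuous_on UNIV g"
    unfolding g_def by (intro S.continuous_on_ruelle_op continuous_on_lipschitz_fun S v)
  have g_pos: "g y > 0" for y
  proof -
    have "card (S -` {y}) > 0" by (simp add: S.card_fibre)
    then have "S -` {y} \<noteq> {}" by (metis card.empty less_irrefl)
    then show ?thesis
      unfolding g_def ruelle_op_def using v(2) by (intro sum_pos S.finite_fibre) auto
  qed
  \<comment> \<open>Dividing by \<open>v\<close> undoes the twist, so the quotient is a positive
    fixed function of the normalized operator of \<open>T\<close>.\<close>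
  have "\<exists>c. (\<lambda>x. g x / v x) = (\<lambda>x. c)"
  proof (rule normalized_positive_eigenfunction[OF T])
    show "continuous_on UNIV (\<lambda>x. g x / v x)"
      using v by (intro continuous_intros g) (auto simp: less_imp_neq[symmetric])
    show "g x / v x > 0" for x using g_pos v by simp
    show "ruelle_op T B (\<lambda>x. g x / v x) = (\<lambda>y. 1 * (g y / v y))"
    proof
      fix y
      show "ruelle_op T B (\<lambda>x. g x / v x) y = 1 * (g y / v y)"
        using fun_cong[OF op_g, of y] v(2)[of y] by (simp add: op_B' field_simps)
    qed
  qed simp
  then obtain c where c: "\<And>x. g x / v x = c" by meson
  have "c > 0" using c[of undefined] g_pos[of undefined] v(2)[of undefined] by auto
  \<comment> \<open>Now \<open>v\<close> is a positive eigenfunction of the normalized operator of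
    \<open>S\<close>, hence also constant.\<close>
  moreover have "ruelle_op S C v = (\<lambda>y. c * v y)"
  proof
    fix y show "ruelle_op S C v y = c * v y"
      using c[of y] v(2)[of y] by (simp add: g_def field_simps)
  qed
  ultimately obtain d where "v = (\<lambda>x. d)"
    using normalized_positive_eigenfunction[OF S v] by blast
  then have "exp (- w x) = exp (- w y)" for x y
    unfolding v_def by metis
  then have "w x = w y" for x y by simp
  then have "B (S x) + C x = C (T x) + B x" for x
    using eq[of x] \<open>\<And>x y. w x = w y\<close>[of x "T x"] \<open>\<And>x y. w x = w y\<close>[of "S x" "T (S x)"] by simp
  then show ?thesis
    by (intro equilibrium_prob_eq_commuting T S ruelle_op_commute T.finite_fibre S.finite_fibre comm)
qed

theorem theorem3p7:
  fixes \<Phi>\<^sub>1 \<Phi>\<^sub>2 :: "'r::finite sequences \<Rightarrow> 'r sequences"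
    and A\<^sub>1 A\<^sub>2 w :: "'r sequences \<Rightarrow> real"
  assumes "\<Phi>\<^sub>1 \<circ> \<Phi>\<^sub>2 = \<Phi>\<^sub>2 \<circ> \<Phi>\<^sub>1"
    and "ruelle_map \<Phi>\<^sub>1" and "ruelle_map \<Phi>\<^sub>2"
    and "lipschitz_fun A\<^sub>1" and "lipschitz_fun A\<^sub>2" and "lipschitz_fun w"
    and "\<And>x. (A\<^sub>1 x - A\<^sub>1 (\<Phi>\<^sub>1 x)) - (A\<^sub>2 x - A\<^sub>2 (\<Phi>\<^sub>2 x)) =
               (w x - w (\<Phi>\<^sub>1 x)) - (w (\<Phi>\<^sub>2 x) - w (\<Phi>\<^sub>1 (\<Phi>\<^sub>2 x)))"
  shows "equilibrium_prob \<Phi>\<^sub>1 A\<^sub>2 = equilibrium_prob \<Phi>\<^sub>2 A\<^sub>1"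
proof -
  obtain u c where u: "lipschitz_fun u" and B: "lipschitz_fun (\<lambda>x. A\<^sub>2 x + (u x - u (\<Phi>\<^sub>1 x)) + c)"
    "ruelle_op \<Phi>\<^sub>1 (\<lambda>x. A\<^sub>2 x + (u x - u (\<Phi>\<^sub>1 x)) + c) (\<lambda>x. 1) = (\<lambda>y. 1)"
    and eqB: "equilibrium_prob \<Phi>\<^sub>1 (\<lambda>x. A\<^sub>2 x + (u x - u (\<Phi>\<^sub>1 x)) + c) = equilibrium_prob \<Phi>\<^sub>1 A\<^sub>2"
    by (rule exists_normalized_potential[OF assms(2,5)])
  obtain v d where v: "lipschitz_fun v" and C: "lipschitz_fun (\<lambda>x. A\<^sub>1 x + (v x - v (\<Phi>\<^sub>2 x)) + d)"
    "ruelle_op \<Phi>\<^sub>2 (\<lambda>x. A\<^sub>1 x + (v x - v (\<Phi>\<^sub>2 x)) + d) (\<lambda>x. 1) = (\<lambda>y. 1)"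
    and eqC: "equilibrium_prob \<Phi>\<^sub>2 (\<lambda>x. A\<^sub>1 x + (v x - v (\<Phi>\<^sub>2 x)) + d) = equilibrium_prob \<Phi>\<^sub>2 A\<^sub>1"
    by (rule exists_normalized_potential[OF assms(3,4)])
  \<comment> \<open>Since the maps commute, normalizing adds to the left-hand side the same double
    difference of \<open>v - u\<close> that the right-hand side forms from \<open>w\<close>; the
    constants \<open>c\<close> and \<open>d\<close> cancel. So \<open>w\<close> becomes
    \<open>w + (v - u)\<close>.\<close>
  have "lipschitz_fun (\<lambda>x. w x + (v x - u x))"
    by (intro lipschitz_fun_add lipschitz_fun_diff assms u v)
  moreover have "\<Phi>\<^sub>2 (\<Phi>\<^sub>1 x) = \<Phi>\<^sub>1 (\<Phi>\<^sub>2 x)" for x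
    using fun_cong[OF assms(1), of x] by simp
  ultimately have "equilibrium_prob \<Phi>\<^sub>1 (\<lambda>x. A\<^sub>2 x + (u x - u (\<Phi>\<^sub>1 x)) + c) =
      equilibrium_prob \<Phi>\<^sub>2 (\<lambda>x. A\<^sub>1 x + (v x - v (\<Phi>\<^sub>2 x)) + d)"
    using assms(7)
    by (intro equilibrium_prob_eq_normalized[OF assms(1,2) B assms(3) C,
          where w = "\<lambda>x. w x + (v x - u x)"]) (auto simp: algebra_simps)
  then show ?thesis by (simp add: eqB eqC)
qed

end
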